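(* Let $n\ge 2$ and let $z_1,\ldots,z_n$ be complex numbers, not necessarily distinct. Let $$S=\{z\in\mathbb{C} : A_n^\gamma(z)=0 \text{ for some } \gamma=(\gamma_1,\ldots,\gamma_n) \text{ with } \gamma_k\ge 0 \text{ for all } k \text{ and } \textstyle\sum_{k=1}^n\gamma_k=1\}.$$ Then $S=H(z_1,z_2,\ldots,z_n)$.
   Context: For complex numbers $z_1,\ldots,z_n$, the incomplete polynomials are $g_k(z)=\prod_{j=1,\,j\ne k}^n(z-z_j)$, $1\le k\le n$. For nonnegative reals $\gamma=(\gamma_1,\ldots,\gamma_n)$ with $\sum_{k=1}^n\gamma_k=1$, $A_n^\gamma(z)=\sum_{k=1}^n\gamma_k g_k(z)$. $H(z_1,\ldots,z_n)$ denotes the closed convex hull of $\{z_1,\ldots,z_n\}$ in $\mathbb{C}$. *)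

theory Defs
  imports "HOL-Analysis.Analysis" "HOL-Computational_Algebra.Polynomial"
begin

text \<open>
  The points are \<open>z 1, \<dots>, z n\<close>, given as a family on the index set \<open>{1..n}\<close> so that
  repetitions are allowed; values of \<open>z\<close> and \<open>\<gamma>\<close> outside \<open>{1..n}\<close> are irrelevant.
\<close>

definition incomplete_poly :: "nat \<Rightarrow> (nat \<Rightarrow> complex) \<Rightarrow> nat \<Rightarrow> complex poly" where
  "incomplete_poly n z k = (\<Prod>j\<in>{1..n} - {k}. [:- z j, 1:])"

definition weights :: "nat \<Rightarrow> (nat \<Rightarrow> real) set" where
  "weights n = {\<gamma>. (\<forall>k\<in>{1..n}. \<gamma> k \<ge> 0) \<and> (\<Sum>k=1..n. \<gamma> k) = 1}"

definition A_poly :: "nat \<Rightarrow> (nat \<Rightarrow> complex) \<Rightarrow> (nat \<Rightarrow> real) \<Rightarrow> complex poly" where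
  "A_poly n z \<gamma> = (\<Sum>k=1..n. smult (complex_of_real (\<gamma> k)) (incomplete_poly n z k))"

definition H :: "nat \<Rightarrow> (nat \<Rightarrow> complex) \<Rightarrow> complex set" where
  "H n z = closure (convex hull (z ` {1..n}))"

end

theory Submission
  imports Defs
begin

text \<open>
  Off the points \<open>z k\<close>, dividing \<open>A\<close> by \<open>\<Prod>j. (w - z j)\<close> turns \<open>A w = 0\<close> into
  \<open>(\<Sum>k. \<gamma> k / (w - z k)) = 0\<close>. Conjugating, \<open>cnj (1 / (w - z k)) = (w - z k) / \<bar>w - z k\<bar>\<^sup>2\<close>, so the
  equation says that \<open>w\<close> is the barycentre of the \<open>z k\<close> with masses \<open>\<gamma> k / \<bar>w - z k\<bar>\<^sup>2\<close>, and the
  passage between \<open>\<gamma>\<close> and the masses is reversible. At \<open>w = z j\<close> put all the weight on some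
  \<open>k \<noteq> j\<close>.
\<close>

text \<open>The masses are attached to indices, so repeated points are allowed, and only their total
  must be positive: dividing by it gives convex coefficients. This leaves masses free to be rescaled
  by distances later.\<close>

lemma convex_hull_image_iff:
  fixes z :: "'i \<Rightarrow> 'a::real_vector"
  assumes "finite I"
  shows "w \<in> convex hull (z ` I) \<longleftrightarrow>
    (\<exists>c. (\<forall>k\<in>I. c k \<ge> 0) \<and> (\<Sum>k\<in>I. c k) > (0::real) \<and> (\<Sum>k\<in>I. c k *\<^sub>R (w - z k)) = 0)"
    (is "_ \<longleftrightarrow> ?R")
proof
  assume w: "w \<in> convex hull (z ` I)"
  \<comment> \<open>\<open>J\<close> holds one index per distinct point, so coefficients on points
    become masses on indices; duplicates get mass 0.\<close>
  obtain J where J: "J \<subseteq> I" "inj_on z J" "z ` I = z ` J"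
    by (meson order_refl subset_image_inj)
  obtain u where u: "\<forall>x\<in>z ` J. 0 \<le> u x" "sum u (z ` J) = 1" "(\<Sum>x\<in>z ` J. u x *\<^sub>R x) = w"
    using w assms J(3) by (auto simp: convex_hull_finite finite_subset[OF J(1)])
  define c where "c k = (if k \<in> J then u (z k) else 0)" for k
  \<comment> \<open>The value type is left general: constant 1 in the reals gives the total mass,
    \<open>f = z\<close> the barycentre.\<close>
  have restr: "(\<Sum>k\<in>I. c k *\<^sub>R f k) = (\<Sum>k\<in>J. u (z k) *\<^sub>R f k)" for f :: "'i \<Rightarrow> 'b::real_vector"
    using assms J(1) by (intro sum.mono_neutral_cong_right) (auto simp: c_def)
  have sum_c: "(\<Sum>k\<in>I. c k) = 1"
    using u(2) restr[of "\<lambda>_. 1::real"] J(2) by (simp add: sum.reindex)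
  have "(\<Sum>k\<in>J. u (z k) *\<^sub>R z k) = w"
    using u(3) J(2) by (simp add: sum.reindex)
  then have "(\<Sum>k\<in>I. c k *\<^sub>R (w - z k)) = 0"
    using sum_c by (simp add: restr[of z] scaleR_diff_right sum_subtractf flip: scaleR_left.sum)
  moreover have "\<forall>k\<in>I. c k \<ge> 0"
    using u(1) by (auto simp: c_def)
  ultimately show ?R
    using sum_c by (intro exI[of _ c]) simp
next
  assume ?R
  then obtain c where c: "\<forall>k\<in>I. c k \<ge> 0" "(\<Sum>k\<in>I. c k) > 0" "(\<Sum>k\<in>I. c k *\<^sub>R (w - z k)) = 0"
    by blast
  define s where "s = (\<Sum>k\<in>I. c k)"
  have "s *\<^sub>R w = (\<Sum>k\<in>I. c k *\<^sub>R z k)"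
    using c(3) by (simp add: s_def scaleR_diff_right sum_subtractf scaleR_left.sum)
  then have "(1 / s) *\<^sub>R (s *\<^sub>R w) = (\<Sum>k\<in>I. (c k / s) *\<^sub>R z k)"
    by (simp add: scaleR_right.sum)
  then have "w = (\<Sum>k\<in>I. (c k / s) *\<^sub>R z k)"
    using c(2) by (simp add: s_def)
  also have "\<dots> \<in> convex hull (z ` I)"
    using assms c by (intro convex_sum) (auto simp: s_def hull_inc simp flip: sum_divide_distrib)
  finally show "w \<in> convex hull (z ` I)" .
qed

text \<open>The convex hull of a finite set is compact, hence closed.\<close>

lemma H_eq_convex_hull: "H n z = convex hull (z ` {1..n})"
  unfolding H_def by (intro closure_closed compact_imp_closed finite_imp_compact_convex_hull) simp

lemma poly_A_poly: "poly (A_poly n z \<gamma>) w = (\<Sum>k=1..n. \<gamma> k * (\<Prod>j\<in>{1..n} - {k}. w - z j))"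
  by (simp add: A_poly_def incomplete_poly_def poly_sum poly_prod)

lemma poly_A_poly_eq_0_iff:
  assumes "w \<notin> z ` {1..n}"
  shows "poly (A_poly n z \<gamma>) w = 0 \<longleftrightarrow>
    (\<Sum>k=1..n. (\<gamma> k / (cmod (w - z k))\<^sup>2) *\<^sub>R (w - z k)) = 0"
proof -
  define P where "P = (\<Prod>j\<in>{1..n}. w - z j)"
  have P: "P \<noteq> 0"
    using assms by (auto simp: P_def)
  have "poly (A_poly n z \<gamma>) w = (\<Sum>k=1..n. P * (\<gamma> k / (w - z k)))"
    unfolding poly_A_poly
  proof (rule sum.cong)
    fix k assume k: "k \<in> {1..n}"
    then have "P = (w - z k) * (\<Prod>j\<in>{1..n} - {k}. w - z j)" "w - z k \<noteq> 0"
      using assms by (auto simp: P_def prod.remove)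
    then show "\<gamma> k * (\<Prod>j\<in>{1..n} - {k}. w - z j) = P * (\<gamma> k / (w - z k))"
      by simp
  qed simp
  then have "poly (A_poly n z \<gamma>) w = 0 \<longleftrightarrow> cnj (\<Sum>k=1..n. \<gamma> k / (w - z k)) = 0"
    using P unfolding sum_distrib_left[symmetric] complex_cnj_zero_iff by simp
  moreover have "cnj (\<Sum>k=1..n. \<gamma> k / (w - z k)) =
      (\<Sum>k=1..n. (\<gamma> k / (cmod (w - z k))\<^sup>2) *\<^sub>R (w - z k))"
    unfolding cnj_sum
  proof (rule sum.cong)
    fix k
    have "cnj (\<gamma> k / (w - z k)) = cnj (\<gamma> k * cnj (w - z k) / (cmod (w - z k))\<^sup>2)"
      by (subst complex_div_cnj) simp
    then show "cnj (\<gamma> k / (w - z k)) = (\<gamma> k / (cmod (w - z k))\<^sup>2) *\<^sub>R (w - z k)"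
      by (simp add: scaleR_conv_of_real)
  qed simp
  ultimately show ?thesis
    by metis
qed

lemma ex_weights_poly_A_poly_eq_0_at_point:
  assumes "n \<ge> 2" "j \<in> {1..n}"
  shows "\<exists>\<gamma>\<in>weights n. poly (A_poly n z \<gamma>) (z j) = 0"
proof -
  \<comment> \<open>Any index other than \<open>j\<close> would do; 2 is in range because
    \<open>n \<ge> 2\<close>.\<close>
  define k where "k = (if j = 1 then 2 else 1 :: nat)"
  define \<gamma> where "\<gamma> i = (if i = k then 1 else 0 :: real)" for i
  have k: "k \<in> {1..n}" "k \<noteq> j"
    using assms by (auto simp: k_def)
  then have "\<gamma> \<in> weights n"
    by (auto simp: weights_def \<gamma>_def)
  moreover have "poly (A_poly n z \<gamma>) (z j) = 0"
    unfolding poly_A_poly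
  proof (intro sum.neutral ballI)
    fix i assume "i \<in> {1..n}"
    \<comment> \<open>For \<open>i = k\<close> the product contains the zero factor
      \<open>l = j\<close>; otherwise the weight is 0.\<close>
    show "complex_of_real (\<gamma> i) * (\<Prod>l\<in>{1..n} - {i}. z j - z l) = 0"
      using k assms(2) by (auto simp: \<gamma>_def)
  qed
  ultimately show ?thesis
    by blast
qed

text \<open>Some \<open>a i\<close> is positive, so its term is too. This keeps the total mass
  positive in both directions between weights and masses.\<close>

lemma sum_mult_pos:
  fixes a b :: "'i \<Rightarrow> 'a::linordered_semidom"
  assumes "finite I" "\<forall>k\<in>I. a k \<ge> 0" "(\<Sum>k\<in>I. a k) > 0" "\<And>k. k \<in> I \<Longrightarrow> b k > 0"
  shows "(\<Sum>k\<in>I. a k * b k) > 0"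
proof -
  obtain i where "i \<in> I" "a i > 0"
    by (metis assms(2,3) less_le order_less_irrefl sum.neutral)
  then show ?thesis
    using assms by (intro sum_pos2[of I i]) (auto simp: less_imp_le)
qed

theorem theorem5p7:
  fixes n :: nat and z :: "nat \<Rightarrow> complex"
  assumes "n \<ge> 2"
  shows "{w. \<exists>\<gamma>\<in>weights n. poly (A_poly n z \<gamma>) w = 0} = H n z"
proof -
  have "(\<exists>\<gamma>\<in>weights n. poly (A_poly n z \<gamma>) w = 0) \<longleftrightarrow> w \<in> convex hull (z ` {1..n})" for w
  \<comment> \<open>The balance equation divides by \<open>w - z k\<close>. At a point of the family
    both sides of the equivalence hold outright.\<close>
  proof (cases "w \<in> z ` {1..n}")
    case True
    then show ?thesis
      using ex_weights_poly_A_poly_eq_0_at_point[OF assms] by (auto intro: hull_inc)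
  next
    case False
    define d where "d k = (cmod (w - z k))\<^sup>2" for k
    have d: "d k > 0" if "k \<in> {1..n}" for k
      using that False by (auto simp: d_def)
    have A: "poly (A_poly n z \<gamma>) w = 0 \<longleftrightarrow> (\<Sum>k=1..n. (\<gamma> k / d k) *\<^sub>R (w - z k)) = 0" for \<gamma>
      unfolding d_def by (rule poly_A_poly_eq_0_iff[OF False])
    show ?thesis
    proof
      assume "\<exists>\<gamma>\<in>weights n. poly (A_poly n z \<gamma>) w = 0"
      then obtain \<gamma> where \<gamma>: "\<forall>k\<in>{1..n}. \<gamma> k \<ge> 0" "(\<Sum>k=1..n. \<gamma> k) = 1"
          "(\<Sum>k=1..n. (\<gamma> k / d k) *\<^sub>R (w - z k)) = 0"
        by (auto simp: weights_def A)
      have "(\<Sum>k=1..n. \<gamma> k * (1 / d k)) > 0"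
        using \<gamma> d by (intro sum_mult_pos) auto
      then show "w \<in> convex hull (z ` {1..n})"
        using \<gamma> d by (subst convex_hull_image_iff) (auto intro!: exI[of _ "\<lambda>k. \<gamma> k / d k"] simp: less_imp_le)
    next
      assume "w \<in> convex hull (z ` {1..n})"
      then obtain c where c: "\<forall>k\<in>{1..n}. c k \<ge> 0" "(\<Sum>k=1..n. c k) > (0::real)"
          "(\<Sum>k=1..n. c k *\<^sub>R (w - z k)) = 0"
        by (subst (asm) convex_hull_image_iff) auto
      \<comment> \<open>The weights \<open>c k * d k\<close> undo the division by
        \<open>d k\<close>; \<open>s\<close> normalises their sum to 1 and only scales the balance
        equation by \<open>1 / s\<close>.\<close>
      define s where "s = (\<Sum>k=1..n. c k * d k)"
      have s: "s > 0"
        unfolding s_def using c d by (intro sum_mult_pos) auto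
      define \<gamma> where "\<gamma> k = c k * d k / s" for k
      have "(\<Sum>k=1..n. \<gamma> k) = 1"
        using s by (simp add: \<gamma>_def s_def flip: sum_divide_distrib)
      moreover have "\<forall>k\<in>{1..n}. \<gamma> k \<ge> 0"
        using c(1) d s by (simp add: \<gamma>_def less_imp_le)
      ultimately have "\<gamma> \<in> weights n"
        by (simp add: weights_def)
      moreover have "(\<Sum>k=1..n. (\<gamma> k / d k) *\<^sub>R (w - z k)) = (\<Sum>k=1..n. (1 / s) *\<^sub>R c k *\<^sub>R (w - z k))"
        using d by (intro sum.cong) (auto simp: \<gamma>_def less_le)
      then have "poly (A_poly n z \<gamma>) w = 0"
        unfolding A scaleR_right.sum[symmetric] c(3) by simp
      ultimately show "\<exists>\<gamma>\<in>weights n. poly (A_poly n z \<gamma>) w = 0"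
        by blast
    qed
  qed
  then show ?thesis
    by (auto simp: H_eq_convex_hull)
qed

end
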